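(* For all positive integers $c_1, c_2$, the following four identities between rational numbers hold: (i) $$\frac{4}{4c_1c_2-c_1-c_2}=\frac{1}{c_1c_2}+\frac{1}{c_2(4c_1c_2-c_1-c_2)}+\frac{1}{c_1(4c_1c_2-c_1-c_2)};$$ (ii) $$\frac{4}{(2c_1+1)(2c_2-1)(4(c_1-c_2)+1)}=\frac{1}{c_1c_2(4(c_1-c_2)+1)}+\frac{1}{2c_1c_2(2c_1+1)(2c_2-1)}+\frac{1}{2c_1c_2(2c_1+1)(2c_2-1)(4(c_1-c_2)+1)};$$ (iii) $$\frac{4}{(2c_1-1)(2c_2-1)(4c_1-1)(4c_2-1)}=\frac{1}{c_1c_2(4c_1-1)(4c_2-1)}+\frac{1}{2c_1c_2(2c_1-1)(2c_2-1)(4c_2-1)}+\frac{1}{2c_1c_2(2c_1-1)(2c_2-1)(4c_1-1)};$$ (iv) $$\frac{4}{(4c_1+1)(4c_2-1)}=\frac{1}{(c_1+c_2)(4c_2-1)}+\frac{1}{2(c_1+c_2)(4c_1+1)}+\frac{1}{2(c_1+c_2)(4c_1+1)}.$$ *)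

theory Defs imports Complex_Main begin

end

theory Submission imports Defs begin

text \<open>Each identity is a linear relation between factors, divided by their common product.
  With \<open>x\<close>, \<open>y\<close> the values of \<open>c1\<close>, \<open>c2\<close>, (i)
  comes from \<open>4xy = d + x + y\<close>, where \<open>d = 4xy - x - y\<close>
  (\<open>four_over_eq\<close>). Both (ii) and (iii) come from \<open>8p = 2m + e + f\<close> with
  \<open>p = xy\<close> (\<open>four_over_product_eq\<close>), and (iv) from
  \<open>4(x + y) = (4x + 1) + (4y - 1)\<close>. Beyond this, only the nonvanishing of the
  denominators has to be checked.\<close>

lemma four_over_eq:
  fixes x y d :: rat
  assumes "x \<noteq> 0" "y \<noteq> 0" "d \<noteq> 0" and "4 * x * y = d + x + y"
  shows "4 / d = 1 / (x * y) + 1 / (y * d) + 1 / (x * d)"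
proof -
  have "4 / d = (4 * x * y) / (x * y * d)"
    using assms(1,2) by simp
  also have "\<dots> = 1 / (x * y) + 1 / (y * d) + 1 / (x * d)"
    unfolding assms(4) using assms(1-3) by (simp add: add_divide_distrib)
  finally show ?thesis .
qed

text \<open>Divide the relation by \<open>2 * p * m * e * f\<close>: each summand on the right
  cancels its own factor. Leaving \<open>m\<close>, \<open>e\<close>, \<open>f\<close> free lets one
  lemma serve both (ii) and (iii).\<close>

lemma four_over_product_eq:
  fixes p m e f :: rat
  assumes "p \<noteq> 0" "m \<noteq> 0" "e \<noteq> 0" "f \<noteq> 0" and "8 * p = 2 * m + e + f"
  shows "4 / (m * e * f) = 1 / (p * e * f) + 1 / (2 * p * m * f) + 1 / (2 * p * m * e)"
proof -
  have "4 / (m * e * f) = (8 * p) / (2 * p * m * e * f)"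
    using assms(1) by simp
  also have "\<dots> = 1 / (p * e * f) + 1 / (2 * p * m * f) + 1 / (2 * p * m * e)"
    unfolding assms(5) using assms(1-4) by (simp add: add_divide_distrib)
  finally show ?thesis .
qed

theorem theorem1:
  fixes c1 c2 :: int
  assumes "c1 > 0" and "c2 > 0"
  shows
   "(4 / rat_of_int (4*c1*c2 - c1 - c2)
       = 1 / rat_of_int (c1*c2)
       + 1 / rat_of_int (c2*(4*c1*c2 - c1 - c2))
       + 1 / rat_of_int (c1*(4*c1*c2 - c1 - c2)))
   \<and>
    (4 / rat_of_int ((2*c1 + 1)*(2*c2 - 1)*(4*(c1 - c2) + 1))
       = 1 / rat_of_int (c1*c2*(4*(c1 - c2) + 1))
       + 1 / rat_of_int (2*c1*c2*(2*c1 + 1)*(2*c2 - 1))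
       + 1 / rat_of_int (2*c1*c2*(2*c1 + 1)*(2*c2 - 1)*(4*(c1 - c2) + 1)))
   \<and>
    (4 / rat_of_int ((2*c1 - 1)*(2*c2 - 1)*(4*c1 - 1)*(4*c2 - 1))
       = 1 / rat_of_int (c1*c2*(4*c1 - 1)*(4*c2 - 1))
       + 1 / rat_of_int (2*c1*c2*(2*c1 - 1)*(2*c2 - 1)*(4*c2 - 1))
       + 1 / rat_of_int (2*c1*c2*(2*c1 - 1)*(2*c2 - 1)*(4*c1 - 1)))
   \<and>
    (4 / rat_of_int ((4*c1 + 1)*(4*c2 - 1))
       = 1 / rat_of_int ((c1 + c2)*(4*c2 - 1))
       + 1 / rat_of_int (2*(c1 + c2)*(4*c1 + 1))
       + 1 / rat_of_int (2*(c1 + c2)*(4*c1 + 1)))"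
proof (intro conjI)
  let ?x = "rat_of_int c1" and ?y = "rat_of_int c2"
  let ?d = "4 * ?x * ?y - ?x - ?y"
  have ge: "?x \<ge> 1" "?y \<ge> 1"
    using assms by simp_all
  \<comment> \<open>This splitting makes the positivity of the denominator visible: all four factors
    are positive integers.\<close>
  have "4 * c1 * c2 - c1 - c2 = c1 * (2 * c2 - 1) + c2 * (2 * c1 - 1)"
    by (simp add: algebra_simps)
  also have "\<dots> > 0"
    using assms by (intro add_pos_pos mult_pos_pos) auto
  finally have "rat_of_int (4 * c1 * c2 - c1 - c2) \<noteq> 0"
    by (simp only: of_int_eq_0_iff)
  then have d: "?d \<noteq> 0"
    by simp
  have "4 / ?d = 1 / (?x * ?y) + 1 / (?y * ?d) + 1 / (?x * ?d)"
    using ge d by (intro four_over_eq) auto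
  then show "4 / rat_of_int (4*c1*c2 - c1 - c2)
       = 1 / rat_of_int (c1*c2)
       + 1 / rat_of_int (c2*(4*c1*c2 - c1 - c2))
       + 1 / rat_of_int (c1*(4*c1*c2 - c1 - c2))"
    by simp
  \<comment> \<open>This factor can be negative, so no sign argument applies; over the integers it
    is nonzero because it is 1 modulo 4.\<close>
  have "4 * (c1 - c2) + 1 \<noteq> 0"
    by presburger
  then have "rat_of_int (4 * (c1 - c2) + 1) \<noteq> 0"
    by (simp only: of_int_eq_0_iff not_False_eq_True)
  then have "4 * (?x - ?y) + 1 \<noteq> 0"
    by simp
  \<comment> \<open>Here \<open>m = (2x + 1)(2y - 1)\<close>, \<open>e = 4(x - y) + 1\<close> and
    \<open>f = 1\<close>; the trailing factors 1 only give the terms the shape of the lemma.\<close>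
  then have "4 / ((2 * ?x + 1) * (2 * ?y - 1) * (4 * (?x - ?y) + 1) * 1)
      = 1 / (?x * ?y * (4 * (?x - ?y) + 1) * 1)
      + 1 / (2 * (?x * ?y) * ((2 * ?x + 1) * (2 * ?y - 1)) * 1)
      + 1 / (2 * (?x * ?y) * ((2 * ?x + 1) * (2 * ?y - 1)) * (4 * (?x - ?y) + 1))"
    using ge by (intro four_over_product_eq) (simp, simp, simp, simp, simp add: algebra_simps)
  then show "4 / rat_of_int ((2*c1 + 1)*(2*c2 - 1)*(4*(c1 - c2) + 1))
       = 1 / rat_of_int (c1*c2*(4*(c1 - c2) + 1))
       + 1 / rat_of_int (2*c1*c2*(2*c1 + 1)*(2*c2 - 1))
       + 1 / rat_of_int (2*c1*c2*(2*c1 + 1)*(2*c2 - 1)*(4*(c1 - c2) + 1))"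
    by (simp add: mult.assoc)
  \<comment> \<open>Here \<open>m = (2x - 1)(2y - 1)\<close>, \<open>e = 4x - 1\<close> and
    \<open>f = 4y - 1\<close>.\<close>
  have "4 / ((2 * ?x - 1) * (2 * ?y - 1) * (4 * ?x - 1) * (4 * ?y - 1))
      = 1 / (?x * ?y * (4 * ?x - 1) * (4 * ?y - 1))
      + 1 / (2 * (?x * ?y) * ((2 * ?x - 1) * (2 * ?y - 1)) * (4 * ?y - 1))
      + 1 / (2 * (?x * ?y) * ((2 * ?x - 1) * (2 * ?y - 1)) * (4 * ?x - 1))"
    using ge by (intro four_over_product_eq) (simp, simp, simp, simp, simp add: algebra_simps)
  then show "4 / rat_of_int ((2*c1 - 1)*(2*c2 - 1)*(4*c1 - 1)*(4*c2 - 1))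
       = 1 / rat_of_int (c1*c2*(4*c1 - 1)*(4*c2 - 1))
       + 1 / rat_of_int (2*c1*c2*(2*c1 - 1)*(2*c2 - 1)*(4*c2 - 1))
       + 1 / rat_of_int (2*c1*c2*(2*c1 - 1)*(2*c2 - 1)*(4*c1 - 1))"
    by (simp add: mult.assoc)
  \<comment> \<open>The last two terms of (iv) are equal and add up to
    \<open>1 / ((x + y)(4x + 1))\<close>, so clearing these three denominators leaves
    \<open>4(x + y) = (4x + 1) + (4y - 1)\<close>.\<close>
  have "?x + ?y \<noteq> 0" "4 * ?x + 1 \<noteq> 0" "4 * ?y - 1 \<noteq> 0"
    using ge by auto
  then show "4 / rat_of_int ((4*c1 + 1)*(4*c2 - 1))
       = 1 / rat_of_int ((c1 + c2)*(4*c2 - 1))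
       + 1 / rat_of_int (2*(c1 + c2)*(4*c1 + 1))
       + 1 / rat_of_int (2*(c1 + c2)*(4*c1 + 1))"
    by (simp add: divide_simps) (simp add: algebra_simps)
qed

end
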